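(* Let $A$ and $E$ be real symmetric $n\times n$ matrices with $\sigma_n>0$, and $\tilde A=A+E$. For $K>0$ let $r_K$ be the number of singular values of $A$ (with multiplicity) that are at most $\frac{\sigma_n}{2}+K\|E\|$. Assume that for some parameter $K>0$, $$\sigma_n\ \ge\ 90\log\!\left(3+\frac{2\sigma_1}{\sigma_n}\right)\cdot\max\left\{\frac{\|E\|}{K},\ \sqrt{r_K\,x\,\|E\|}\right\}.$$ Then $\tilde\sigma_n\ge\sigma_n/2$.
   Context: $\|\cdot\|$ is the spectral norm; $\log$ is natural. $\sigma_1\ge\dots\ge\sigma_n$ are the singular values of $A$ and $\tilde\sigma_1\ge\dots\ge\tilde\sigma_n$ those of $\tilde A$. Fix an orthonormal eigenbasis $u_1,\dots,u_n$ of $A$ (any choice is allowed when eigenvalues are multiple) and put $x:=\max_{1\le i,j\le n}|u_i^\top E u_j|$. *)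

theory Defs
  imports "HOL-Analysis.Analysis" "HOL-Computational_Algebra.Computational_Algebra"
begin

definition charpoly :: "real ^ 'n ^ 'n \<Rightarrow> real poly" where
  "charpoly M = det (\<chi> i j. (if i = j then [:0, 1:] else 0) - [:M $ i $ j:])"

text \<open>The square roots of the eigenvalues of \<open>A\<^sup>T A\<close>, in decreasing order. Multiplicities are
  algebraic; as \<open>A\<^sup>T A\<close> is symmetric and positive semidefinite, its characteristic polynomial splits
  over the reals with nonnegative roots, so the list has length \<open>CARD('n)\<close>.\<close>

definition singular_values :: "real ^ 'n ^ 'n \<Rightarrow> real list" where
  "singular_values A =
     rev (sorted_list_of_multiset (image_mset sqrt (proots (charpoly (transpose A ** A)))))"

text \<open>Indices run from 1 to \<open>CARD('n)\<close>, as in \<open>\<sigma>\<^sub>1 \<ge> \<dots> \<ge> \<sigma>\<^sub>n\<close>.\<close>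

definition singular_value :: "real ^ 'n ^ 'n \<Rightarrow> nat \<Rightarrow> real" where
  "singular_value A k = singular_values A ! (k - 1)"

definition spectral_norm :: "real ^ 'n ^ 'n \<Rightarrow> real" where
  "spectral_norm A = onorm (\<lambda>v. A *v v)"

definition orthonormal_eigenbasis :: "real ^ 'n ^ 'n \<Rightarrow> ('n \<Rightarrow> real ^ 'n) \<Rightarrow> bool" where
  "orthonormal_eigenbasis A u \<longleftrightarrow>
     (\<forall>i j. u i \<bullet> u j = (if i = j then 1 else 0)) \<and>
     (\<forall>i. \<exists>c. A *v u i = c *\<^sub>R u i)"

end

(* An eigenvector v of A + E with eigenvalue mu, |mu| < s/2 where s = sigma_n, satisfies
   (c_i - mu) <u_i, v> = - <u_i, E v> in the eigenbasis of A.  First, s/2 <= ||E||, which forces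
   K >= 45 and makes r x tiny compared with s.  Split the coordinates at |c_i| = s/2 + K ||E||:
   those above have |c_i - mu| >= K ||E||, so that part of v has norm at most 1/K.  On the r
   coordinates below, |c_i - mu| >= s/2, whereas E compressed to their span has norm at most r x and
   the remaining part of v contributes at most ||E||/K.  So that part of v cannot have norm close
   to 1.  Of the logarithmic factor only ln 3 >= 1 is needed. *)

theory Submission imports Defs begin

unbundle no fps_syntax

section \<open>Spectral theorem for real symmetric matrices\<close>

lemma symmetric_inner:
  fixes M :: "real ^ 'n ^ 'n"
  assumes "transpose M = M"
  shows "(M *v v) \<bullet> w = v \<bullet> (M *v w)"
  by (metis assms dot_lmul_matrix vector_transpose_matrix)

text \<open>A maximiser of the Rayleigh quotient on the unit sphere of \<open>W\<close> is an
  eigenvector. Invariance keeps the residual \<open>m *\<^sub>R v - M *v v\<close> inside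
  \<open>W\<close>, where maximality can be tested. Working in a subspace allows later use on
  orthogonal complements.\<close>

lemma symmetric_eigenvector_in_subspace:
  fixes M :: "real ^ 'n ^ 'n"
  assumes sym: "transpose M = M" and W: "subspace W" and inv: "\<And>w. w \<in> W \<Longrightarrow> M *v w \<in> W"
    and nz: "z \<in> W" "z \<noteq> 0"
  obtains v c where "v \<in> W" "v \<bullet> v = 1" "M *v v = c *\<^sub>R v"
proof -
  let ?S = "W \<inter> sphere 0 1"
  have "compact ?S"
    using closed_subspace[OF W] by (simp add: closed_Int_compact)
  moreover have "z /\<^sub>R norm z \<in> ?S"
    using nz W by (simp add: subspace_scale)
  moreover have "continuous_on ?S (\<lambda>v. v \<bullet> (M *v v))"
    by (intro continuous_intros linear_continuous_on matrix_vector_mul_bounded_linear)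
  ultimately obtain v where v: "v \<in> ?S" and vmax: "\<And>w. w \<in> ?S \<Longrightarrow> w \<bullet> (M *v w) \<le> v \<bullet> (M *v v)"
    using continuous_attains_sup[of ?S "\<lambda>v. v \<bullet> (M *v v)"] by blast
  define m where "m = v \<bullet> (M *v v)"
  \<comment> \<open>The quadratic form of \<open>m I - M\<close>: nonnegative on \<open>W\<close>
    because \<open>m\<close> is the maximum, and zero at \<open>v\<close>.\<close>
  define g where "g w = m * (w \<bullet> w) - w \<bullet> (M *v w)" for w
  have vv: "v \<bullet> v = 1" using v by (simp add: norm_eq_1)
  have g_nonneg: "g w \<ge> 0" if "w \<in> W" for w
  proof (cases "w = 0")
    case False
    have "w /\<^sub>R norm w \<in> ?S" using False that W by (simp add: subspace_scale)
    from vmax[OF this] have "(w \<bullet> (M *v w)) / (norm w)\<^sup>2 \<le> m"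
      by (simp add: m_def matrix_vector_mult_scaleR power2_eq_square field_simps)
    then show ?thesis using False by (simp add: g_def field_simps power2_norm_eq_inner)
  qed (simp add: g_def)
  define w where "w = m *\<^sub>R v - M *v v"
  have "w \<in> W" using v W inv by (simp add: w_def subspace_diff subspace_scale)
  have expand: "g (v + t *\<^sub>R w) = 2 * t * (w \<bullet> w) + t\<^sup>2 * g w" for t
  proof -
    have "g (v + t *\<^sub>R w) = g v + 2 * t * (m * (v \<bullet> w) - v \<bullet> (M *v w)) + t\<^sup>2 * g w"
      using symmetric_inner[OF sym, of v w]
      by (simp add: g_def matrix_vector_right_distrib matrix_vector_mult_scaleR inner_simps
          power2_eq_square algebra_simps inner_commute)
    moreover have "m * (v \<bullet> w) - v \<bullet> (M *v w) = w \<bullet> w"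
      using symmetric_inner[OF sym, of v w] by (simp add: w_def inner_diff_left)
    moreover have "g v = 0" by (simp add: g_def m_def vv)
    ultimately show ?thesis by simp
  qed
  have "w \<bullet> w = 0"
  proof (rule ccontr)
    assume "w \<bullet> w \<noteq> 0"
    then have pos: "w \<bullet> w > 0" by simp
    \<comment> \<open>For small negative \<open>t\<close> the linear term of \<open>expand\<close>
      beats the quadratic one. The \<open>+ 1\<close> keeps the denominator positive and makes
      \<open>\<bar>t * g w\<bar>\<close> at most \<open>w \<bullet> w\<close>, half of what the
      linear term supplies.\<close>
    define t where "t = - (w \<bullet> w) / (g w + 1)"
    have gw: "g w \<ge> 0" using g_nonneg \<open>w \<in> W\<close> by blast
    have t: "t < 0" using pos gw by (simp add: t_def divide_neg_pos)
    have "0 \<le> t * (2 * (w \<bullet> w) + t * g w)"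
      using g_nonneg[of "v + t *\<^sub>R w"] v \<open>w \<in> W\<close> W expand[of t]
      by (simp add: subspace_add subspace_scale power2_eq_square algebra_simps)
    then have "2 * (w \<bullet> w) + t * g w \<le> 0" using t by (simp add: zero_le_mult_iff)
    moreover have "t * g w \<ge> - (w \<bullet> w)"
      using gw pos by (simp add: t_def field_simps)
    ultimately show False using pos by linarith
  qed
  then have "M *v v = m *\<^sub>R v" by (simp add: w_def)
  then show thesis using that v vv by blast
qed

text \<open>Eigenvectors are added one index at a time: by symmetry, the orthogonal complement of
  those already found is invariant under \<open>M\<close>.\<close>

lemma symmetric_orthonormal_eigenvectors:
  fixes M :: "real ^ 'n ^ 'n" and J :: "'n set"
  assumes sym: "transpose M = M"
  shows "\<exists>u. (\<forall>i\<in>J. \<forall>j\<in>J. u i \<bullet> u j = (if i = j then 1 else 0)) \<and> (\<forall>i\<in>J. \<exists>c. M *v u i = c *\<^sub>R u i)"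
proof (induction J rule: finite_induct[OF finite])
  case 1
  then show ?case by simp
next
  case (2 k J)
  then obtain u where orth: "\<And>i j. i \<in> J \<Longrightarrow> j \<in> J \<Longrightarrow> u i \<bullet> u j = (if i = j then 1 else 0)"
    and eig: "\<And>i. i \<in> J \<Longrightarrow> \<exists>c. M *v u i = c *\<^sub>R u i" by metis
  define W where "W = {w. \<forall>j\<in>J. u j \<bullet> w = 0}"
  have "subspace W" by (auto simp: W_def subspace_def inner_simps)
  moreover have "M *v w \<in> W" if "w \<in> W" for w
  proof -
    have "u j \<bullet> (M *v w) = 0" if "j \<in> J" for j
      using eig[OF that] that \<open>w \<in> W\<close> symmetric_inner[OF sym, of "u j" w] by (auto simp: W_def)
    then show ?thesis by (simp add: W_def)
  qed
  \<comment> \<open>Dimension count: \<open>k\<close> lies outside \<open>J\<close>, so fewer than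
    \<open>CARD('n)\<close> vectors have been chosen and their complement is not zero.\<close>
  moreover obtain z where "z \<in> W" "z \<noteq> 0"
  proof -
    have "dim (u ` J) \<le> card (u ` J)" by (rule dim_le_card') simp
    also have "\<dots> \<le> card J" by (rule card_image_le) simp
    also have "\<dots> < CARD('n)" using 2 by (metis UNIV_I finite psubset_card_mono psubsetI subset_UNIV)
    finally have "dim (u ` J) < DIM(real ^ 'n)" by simp
    then obtain z where "z \<noteq> 0" "\<And>y. y \<in> span (u ` J) \<Longrightarrow> orthogonal z y"
      using orthogonal_to_subspace_exists by metis
    then show thesis using that[of z]
      by (auto simp: W_def orthogonal_def inner_commute[of _ z] span_base)
  qed
  ultimately obtain v c where v: "v \<in> W" "v \<bullet> v = 1" "M *v v = c *\<^sub>R v"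
    using symmetric_eigenvector_in_subspace[OF sym] by metis
  have "\<forall>i\<in>insert k J. \<forall>j\<in>insert k J. (u(k := v)) i \<bullet> (u(k := v)) j = (if i = j then 1 else 0)"
    using orth v 2 by (auto simp: W_def inner_commute)
  moreover have "\<forall>i\<in>insert k J. \<exists>c. M *v (u(k := v)) i = c *\<^sub>R (u(k := v)) i"
    using eig v by auto
  ultimately show ?case by blast
qed

lemma symmetric_orthonormal_eigenbasis_exists:
  fixes M :: "real ^ 'n ^ 'n"
  assumes "transpose M = M"
  obtains u where "orthonormal_eigenbasis M u"
  using symmetric_orthonormal_eigenvectors[OF assms, of UNIV] by (auto simp: orthonormal_eigenbasis_def)

section \<open>Coordinates in an orthonormal basis\<close>

lemma orthogonal_matrix_of_orthonormal:
  fixes u :: "'n \<Rightarrow> real ^ 'n"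
  assumes "\<And>i j. u i \<bullet> u j = (if i = j then 1 else 0)"
  shows "orthogonal_matrix (\<chi> i. u i)"
  unfolding orthogonal_matrix_orthonormal_rows
  using assms by (auto simp: row_def orthogonal_def norm_eq_1)

text \<open>Parseval: the matrix with rows \<open>u i\<close> is an isometry, and it sends
  \<open>y\<close> to its coordinate vector.\<close>

lemma norm_orthonormal_basis:
  fixes u :: "'n \<Rightarrow> real ^ 'n"
  assumes "\<And>i j. u i \<bullet> u j = (if i = j then 1 else 0)"
  shows "norm y = L2_set (\<lambda>i. u i \<bullet> y) UNIV"
proof -
  have "norm y = norm ((\<chi> i. u i) *v y)"
    using orthogonal_matrix_of_orthonormal[of u, OF assms]
    by (metis orthogonal_transformation_norm orthogonal_transformation_matrix matrix_of_matrix_vector_mul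
        matrix_vector_mul_linear)
  also have "\<dots> = L2_set (\<lambda>i. u i \<bullet> y) UNIV"
    by (simp add: norm_vec_def matrix_vector_mul_component) (simp add: L2_set_def)
  finally show ?thesis .
qed

text \<open>The difference of the two sides has only zero coordinates, so Parseval makes it
  vanish.\<close>

lemma orthonormal_basis_expansion:
  fixes u :: "'n \<Rightarrow> real ^ 'n"
  assumes "\<And>i j. u i \<bullet> u j = (if i = j then 1 else 0)"
  shows "y = (\<Sum>i\<in>UNIV. (u i \<bullet> y) *\<^sub>R u i)"
proof -
  let ?z = "y - (\<Sum>i\<in>UNIV. (u i \<bullet> y) *\<^sub>R u i)"
  have "u j \<bullet> ?z = 0" for j
    by (simp add: inner_diff_right inner_sum_right assms if_distrib cong: if_cong)
  then have "norm ?z = 0"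
    by (simp add: norm_orthonormal_basis[of u ?z, OF assms] L2_set_0')
  then show ?thesis by simp
qed

section \<open>Singular values of a symmetric matrix as absolute eigenvalues\<close>

lemma poly_charpoly:
  "poly (charpoly M) t = det (mat t - M)"
proof -
  have "poly (charpoly M) t = det (\<chi> i j. poly ((if i = j then [:0, 1:] else 0) - [:M $ i $ j:]) t)"
    by (simp add: charpoly_def det_def poly_sum poly_prod)
  also have "(\<chi> i j. poly ((if i = j then [:0, 1:] else 0) - [:M $ i $ j:]) t) = mat t - M"
    by (simp add: vec_eq_iff mat_def)
  finally show ?thesis .
qed

text \<open>The matrix \<open>Q\<close> with columns \<open>u i\<close> diagonalises
  \<open>mat t - M\<close>, so the determinants agree for every real \<open>t\<close>; polynomials
  that agree at all reals are equal.\<close>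

lemma charpoly_orthonormal_eigenbasis:
  fixes M :: "real ^ 'n ^ 'n" and u :: "'n \<Rightarrow> real ^ 'n"
  assumes orth: "\<And>i j. u i \<bullet> u j = (if i = j then 1 else 0)"
    and eig: "\<And>i. M *v u i = c i *\<^sub>R u i"
  shows "charpoly M = (\<Prod>i\<in>UNIV. [:- c i, 1:])"
proof -
  define Q :: "real ^ 'n ^ 'n" where "Q = transpose (\<chi> i. u i)"
  define D :: "real \<Rightarrow> real ^ 'n ^ 'n" where "D t = (\<chi> i j. if i = j then t - c i else 0)" for t
  have "orthogonal_matrix Q"
    unfolding Q_def using orthogonal_matrix_of_orthonormal[of u, OF orth] by simp
  then have detQ: "det Q \<noteq> 0"
    using det_orthogonal_matrix by fastforce
  have "(mat t - M) ** Q = Q ** D t" for t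
  proof -
    have "((mat t - M) ** Q) $ i $ j = (Q ** D t) $ i $ j" for i j
    proof -
      have "((mat t - M) ** Q) $ i $ j = ((mat t - M) *v u j) $ i"
        by (simp add: matrix_matrix_mult_def matrix_vector_mult_def Q_def transpose_def)
      also have "(mat t - M) *v u j = (t - c j) *\<^sub>R u j"
      proof -
        have "mat t *v u j = t *\<^sub>R u j"
          by (simp add: vec_eq_iff mat_def matrix_vector_mult_def if_distrib [of "\<lambda>x. x * y" for y] cong: if_cong)
        then show ?thesis
          by (simp add: matrix_vector_mult_diff_rdistrib eig scaleR_diff_left)
      qed
      also have "((t - c j) *\<^sub>R u j) $ i = (Q ** D t) $ i $ j"
        by (simp add: matrix_matrix_mult_def Q_def D_def transpose_def if_distrib cong: if_cong)
      finally show ?thesis .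
    qed
    then show ?thesis by (simp add: vec_eq_iff)
  qed
  then have "det (mat t - M) = det (D t)" for t
    using detQ by (metis det_mul mult.commute mult_cancel_left)
  moreover have "det (D t) = (\<Prod>i\<in>UNIV. t - c i)" for t
    by (subst det_diagonal) (auto simp: D_def)
  ultimately have "poly (charpoly M) = poly (\<Prod>i\<in>UNIV. [:- c i, 1:])"
    by (auto simp: poly_charpoly poly_prod)
  then show ?thesis by (simp add: poly_eq_poly_eq_iff)
qed

text \<open>The same basis diagonalises the square of \<open>M\<close>, with eigenvalues
  \<open>(c i)\<^sup>2\<close>, whose roots are \<open>\<bar>c i\<bar>\<close>. Multisets keep the
  multiplicities, which matter for counting.\<close>

lemma mset_singular_values:
  fixes M :: "real ^ 'n ^ 'n" and u :: "'n \<Rightarrow> real ^ 'n"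
  assumes sym: "transpose M = M"
    and orth: "\<And>i j. u i \<bullet> u j = (if i = j then 1 else 0)"
    and eig: "\<And>i. M *v u i = c i *\<^sub>R u i"
  shows "mset (singular_values M) = image_mset (\<lambda>i. \<bar>c i\<bar>) (mset_set UNIV)"
proof -
  have "(transpose M ** M) *v u i = (c i)\<^sup>2 *\<^sub>R u i" for i
    by (simp add: sym eig matrix_vector_mult_scaleR power2_eq_square flip: matrix_vector_mul_assoc)
  then have "charpoly (transpose M ** M) = (\<Prod>i\<in>UNIV. [:- (c i)\<^sup>2, 1:])"
    by (rule charpoly_orthonormal_eigenbasis[of u, OF orth])
  then have "proots (charpoly (transpose M ** M)) = (\<Sum>i\<in>UNIV. {#(c i)\<^sup>2#})"
    by (simp add: proots_prod)
  also have "\<dots> = image_mset (\<lambda>i. (c i)\<^sup>2) (mset_set UNIV)"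
    by (simp add: sum_unfold_sum_mset)
  finally show ?thesis
    by (simp add: singular_values_def multiset.map_comp o_def)
qed

text \<open>Three consequences of the multiset identity: the length validates list indices, the set
  identifies the minimum, and the filtered length turns \<open>r\<close> into a count of eigenvalue
  indices.\<close>

lemma singular_values_eigenvalues:
  fixes M :: "real ^ 'n ^ 'n" and u :: "'n \<Rightarrow> real ^ 'n"
  assumes "transpose M = M"
    and "\<And>i j. u i \<bullet> u j = (if i = j then 1 else 0)"
    and "\<And>i. M *v u i = c i *\<^sub>R u i"
  shows length_singular_values: "length (singular_values M) = CARD('n)"
    and set_singular_values: "set (singular_values M) = range (\<lambda>i. \<bar>c i\<bar>)"
    and length_filter_singular_values: "length (filter P (singular_values M)) = card {i. P \<bar>c i\<bar>}"
proof -
  note ms = mset_singular_values[of M u c, OF assms]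
  show "length (singular_values M) = CARD('n)"
    using arg_cong[OF ms, of size] by simp
  show "set (singular_values M) = range (\<lambda>i. \<bar>c i\<bar>)"
    using arg_cong[OF ms, of set_mset] by simp
  have "length (filter P (singular_values M)) = size (filter_mset P (mset (singular_values M)))"
    by (simp flip: mset_filter)
  also have "\<dots> = card {i. P \<bar>c i\<bar>}"
    by (simp add: ms flip: image_mset_filter_mset_swap)
  finally show "length (filter P (singular_values M)) = card {i. P \<bar>c i\<bar>}" .
qed

lemma singular_value_last:
  fixes M :: "real ^ 'n ^ 'n" and u :: "'n \<Rightarrow> real ^ 'n"
  assumes "transpose M = M"
    and "\<And>i j. u i \<bullet> u j = (if i = j then 1 else 0)"
    and "\<And>i. M *v u i = c i *\<^sub>R u i"
  shows "singular_value M CARD('n) = Min (range (\<lambda>i. \<bar>c i\<bar>))"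
proof -
  note len = length_singular_values[of M u c, OF assms]
  note set_sv = set_singular_values[of M u c, OF assms]
  have ne: "singular_values M \<noteq> []" using len by auto
  \<comment> \<open>Index \<open>CARD('n)\<close> is list position \<open>CARD('n) - 1\<close>, the
    last one, hence the head of the ascending list.\<close>
  have "singular_value M CARD('n) = hd (rev (singular_values M))"
    using ne len by (simp add: singular_value_def hd_rev last_conv_nth)
  moreover have "hd (rev (singular_values M)) \<le> s" if "s \<in> set (singular_values M)" for s
  proof -
    have "sorted (rev (singular_values M))" by (simp add: singular_values_def)
    moreover have "rev (singular_values M) \<noteq> []" "s \<in> set (rev (singular_values M))" using ne that by auto
    ultimately show ?thesis by (cases "rev (singular_values M)") auto
  qed
  moreover have "hd (rev (singular_values M)) \<in> set (singular_values M)"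
    using ne by (simp add: hd_rev)
  ultimately have "singular_value M CARD('n) = Min (set (singular_values M))"
    by (intro Min_eqI[symmetric]) auto
  then show ?thesis by (simp add: set_sv)
qed

section \<open>Norm estimates and perturbation of a single eigenvalue\<close>

lemma norm_matrix_vector_le:
  "norm (E *v v) \<le> spectral_norm E * norm v"
  unfolding spectral_norm_def by (intro onorm matrix_vector_mul_bounded_linear)

lemma L2_set_mono_set:
  assumes "finite T" "S \<subseteq> T"
  shows "L2_set f S \<le> L2_set f T"
  unfolding L2_set_def using assms by (intro real_sqrt_le_mono sum_mono2) auto

lemma L2_set_abs_mono:
  assumes "\<And>i. i \<in> S \<Longrightarrow> \<bar>f i\<bar> \<le> \<bar>g i\<bar>"
  shows "L2_set f S \<le> L2_set g S"
  unfolding L2_set_def using assms by (intro real_sqrt_le_mono sum_mono) (simp add: abs_le_square_iff)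

text \<open>Bounds the compression of the perturbation. Cauchy-Schwarz in each row costs one factor
  \<open>sqrt (card S)\<close>, and collecting the rows costs another.\<close>

lemma L2_set_matrix_le:
  assumes S: "finite S" and x: "\<And>i j. i \<in> S \<Longrightarrow> j \<in> S \<Longrightarrow> \<bar>m i j\<bar> \<le> x" "0 \<le> x"
  shows "L2_set (\<lambda>i. \<Sum>j\<in>S. a j * m i j) S \<le> real (card S) * x * L2_set a S"
proof -
  let ?b = "L2_set a S * sqrt (real (card S)) * x"
  have "\<bar>\<Sum>j\<in>S. a j * m i j\<bar> \<le> \<bar>?b\<bar>" if "i \<in> S" for i
  proof -
    have "\<bar>\<Sum>j\<in>S. a j * m i j\<bar> \<le> (\<Sum>j\<in>S. \<bar>a j * m i j\<bar>)" by (rule sum_abs)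
    also have "\<dots> \<le> (\<Sum>j\<in>S. \<bar>a j\<bar> * \<bar>1\<bar> * x)"
      using x that by (intro sum_mono) (simp add: abs_mult mult_left_mono)
    also have "\<dots> = (\<Sum>j\<in>S. \<bar>a j\<bar> * \<bar>1\<bar>) * x" by (simp add: sum_distrib_right)
    also have "\<dots> \<le> ?b"
      using L2_set_mult_ineq[of a "\<lambda>_. 1" S] x by (intro mult_right_mono) (simp_all add: L2_set_constant)
    finally show ?thesis by simp
  qed
  then have "L2_set (\<lambda>i. \<Sum>j\<in>S. a j * m i j) S \<le> L2_set (\<lambda>_. ?b) S"
    by (rule L2_set_abs_mono)
  also have "\<dots> = real (card S) * x * L2_set a S"
    using x by (simp add: L2_set_constant abs_mult)
  finally show ?thesis .
qed

text \<open>Treats one eigenpair of \<open>A + E\<close> at a time. The logarithm has already been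
  replaced by its lower bound 1, and \<open>s\<close> stands for any positive lower bound of the
  \<open>\<bar>c i\<bar>\<close>.\<close>

lemma perturbed_eigenvalue_bound:
  fixes A E :: "real ^ 'n ^ 'n" and u :: "'n \<Rightarrow> real ^ 'n"
  assumes symA: "transpose A = A"
    and orth: "\<And>i j. u i \<bullet> u j = (if i = j then 1 else 0)"
    and eig: "\<And>i. A *v u i = c i *\<^sub>R u i"
    and s: "s > 0" "\<And>i. s \<le> \<bar>c i\<bar>"
    and x: "\<And>i j. \<bar>u i \<bullet> (E *v u j)\<bar> \<le> x"
    and K: "K > 0"
    and g1: "s \<ge> 90 * (spectral_norm E / K)"
    and g2: "s \<ge> 90 * sqrt (real (card {i. \<bar>c i\<bar> \<le> s / 2 + K * spectral_norm E}) * x * spectral_norm E)"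
    and v: "v \<bullet> v = 1" "(A + E) *v v = \<mu> *\<^sub>R v"
  shows "s / 2 \<le> \<bar>\<mu>\<bar>"
proof (rule ccontr)
  assume "\<not> s / 2 \<le> \<bar>\<mu>\<bar>"
  then have \<mu>: "\<bar>\<mu>\<bar> < s / 2" by simp
  define e where "e = spectral_norm E"
  define S where "S = {i. \<bar>c i\<bar> \<le> s / 2 + K * e}"
  define a where "a i = u i \<bullet> v" for i
  define b where "b i = u i \<bullet> (E *v v)" for i
  have x0: "0 \<le> x" using x[of undefined undefined] by linarith
  have coord: "\<bar>b i\<bar> = \<bar>c i - \<mu>\<bar> * \<bar>a i\<bar>" for i
  proof -
    have "u i \<bullet> (A *v v) + b i = \<mu> * a i"
      using arg_cong[OF v(2), of "inner (u i)"]
      by (simp add: a_def b_def matrix_vector_mult_add_rdistrib inner_add_right)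
    moreover have "u i \<bullet> (A *v v) = c i * a i"
      using symmetric_inner[OF symA, of "u i" v] by (simp add: eig a_def)
    ultimately have "b i = - ((c i - \<mu>) * a i)" by (simp add: algebra_simps)
    then show ?thesis by (simp add: abs_mult)
  qed
  have e0: "0 \<le> e" unfolding e_def spectral_norm_def by (intro onorm_pos_le matrix_vector_mul_bounded_linear)
  have norm_v: "norm v = 1" using v by (simp add: norm_eq_1)
  have a_UNIV: "L2_set a UNIV = 1"
    using norm_orthonormal_basis[of u v, OF orth] norm_v by (simp add: a_def[abs_def])
  have b_UNIV: "L2_set b UNIV \<le> e"
    using norm_orthonormal_basis[of u "E *v v", OF orth] norm_matrix_vector_le[of E v] norm_v
    by (simp add: b_def[abs_def] e_def)
  \<comment> \<open>Each \<open>c i\<close> is at distance at least \<open>s / 2\<close> from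
    \<open>\<mu>\<close>. Taking \<open>T = UNIV\<close> gives \<open>s / 2 \<le> e\<close>; taking
    \<open>T = S\<close> starts the final chain of estimates.\<close>
  have low: "L2_set (\<lambda>i. s / 2 * a i) T \<le> L2_set b T" for T
  proof (rule L2_set_abs_mono)
    fix i
    have "s / 2 \<le> \<bar>c i - \<mu>\<bar>" using s(2)[of i] \<mu> by linarith
    then show "\<bar>s / 2 * a i\<bar> \<le> \<bar>b i\<bar>"
      using s(1) mult_right_mono[of "s / 2" "\<bar>c i - \<mu>\<bar>" "\<bar>a i\<bar>"] by (simp add: coord abs_mult)
  qed
  have "s / 2 \<le> e"
    using low[of UNIV] b_UNIV a_UNIV s L2_set_right_distrib[of "s / 2" a UNIV] by simp
  then have e_pos: "e > 0" using s by linarith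
  have "90 * e \<le> s * K" using g1 K by (simp add: e_def field_simps)
  then have "90 * (s / 2) \<le> s * K" using \<open>s / 2 \<le> e\<close> by linarith
  then have K45: "K \<ge> 45" using s by simp
  have a_out: "L2_set a (- S) \<le> 1 / K"
  proof -
    have "K * e * L2_set a (- S) = L2_set (\<lambda>i. K * e * a i) (- S)"
      using K e0 by (simp add: L2_set_right_distrib)
    also have "\<dots> \<le> L2_set b (- S)"
    proof (rule L2_set_abs_mono)
      fix i assume "i \<in> - S"
      then have "K * e \<le> \<bar>c i - \<mu>\<bar>" using \<mu> by (simp add: S_def)
      then show "\<bar>K * e * a i\<bar> \<le> \<bar>b i\<bar>"
        using K e0 by (simp add: coord abs_mult mult_right_mono)
    qed
    also have "\<dots> \<le> e"
      using L2_set_mono_set[of UNIV "- S" b] b_UNIV by simp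
    finally show ?thesis using K e_pos by (simp add: field_simps)
  qed
  define p where "p = (\<Sum>i\<in>S. a i *\<^sub>R u i)"
  define q where "q = (\<Sum>i\<in>-S. a i *\<^sub>R u i)"
  have v_split: "v = p + q"
    unfolding p_def q_def using orthonormal_basis_expansion[of u v, OF orth]
      sum.union_disjoint[of S "- S" "\<lambda>i. a i *\<^sub>R u i"] by (simp add: a_def)
  \<comment> \<open>Parseval again: the partial sum has coordinates \<open>a j\<close> on
    \<open>T\<close> and zero elsewhere.\<close>
  have norm_part: "norm (\<Sum>i\<in>T. a i *\<^sub>R u i) = L2_set a T" for T
  proof -
    have "u j \<bullet> (\<Sum>i\<in>T. a i *\<^sub>R u i) = (if j \<in> T then a j else 0)" for j
      by (simp add: inner_sum_right orth if_distrib cong: if_cong)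
    then have "norm (\<Sum>i\<in>T. a i *\<^sub>R u i) = L2_set (\<lambda>j. if j \<in> T then a j else 0) UNIV"
      by (simp add: norm_orthonormal_basis[of u, OF orth])
    also have "\<dots> = L2_set a T"
      by (simp add: L2_set_def if_distrib[of "\<lambda>y. y\<^sup>2"] sum.If_cases)
    finally show ?thesis .
  qed
  have "1 \<le> L2_set a S + L2_set a (- S)"
    using norm_triangle_ineq[of p q] norm_v v_split by (simp add: p_def q_def norm_part)
  moreover have "1 / K \<le> 1 / 45" using K45 by (simp add: field_simps)
  ultimately have a_in: "L2_set a S \<ge> 44 / 45" using a_out by linarith
  have "s / 2 * L2_set a S \<le> L2_set b S"
    using low[of S] s L2_set_right_distrib[of "s / 2" a S] by simp
  also have "L2_set b S = L2_set (\<lambda>i. u i \<bullet> (E *v p) + u i \<bullet> (E *v q)) S"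
    unfolding b_def[abs_def] by (simp add: v_split matrix_vector_right_distrib inner_add_right)
  also have "\<dots> \<le> L2_set (\<lambda>i. u i \<bullet> (E *v p)) S + L2_set (\<lambda>i. u i \<bullet> (E *v q)) S"
    by (rule L2_set_triangle_ineq)
  also have "L2_set (\<lambda>i. u i \<bullet> (E *v p)) S \<le> real (card S) * x * L2_set a S"
  proof -
    have "u i \<bullet> (E *v p) = (\<Sum>j\<in>S. a j * (u i \<bullet> (E *v u j)))" for i
      by (simp add: p_def linear_sum[OF matrix_vector_mul_linear] matrix_vector_mult_scaleR inner_sum_right)
    then show ?thesis using L2_set_matrix_le[of S "\<lambda>i j. u i \<bullet> (E *v u j)" x a] x x0 by simp
  qed
  also have "L2_set (\<lambda>i. u i \<bullet> (E *v q)) S \<le> e * (1 / K)"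
  proof -
    have "L2_set (\<lambda>i. u i \<bullet> (E *v q)) S \<le> norm (E *v q)"
      using L2_set_mono_set[of UNIV S "\<lambda>i. u i \<bullet> (E *v q)"] norm_orthonormal_basis[of u "E *v q", OF orth] by simp
    also have "\<dots> \<le> e * norm q" using norm_matrix_vector_le[of E q] by (simp add: e_def)
    also have "\<dots> \<le> e * (1 / K)" using a_out e0 by (intro mult_left_mono) (simp_all add: q_def norm_part)
    finally show ?thesis .
  qed
  finally have main: "(s / 2 - real (card S) * x) * L2_set a S \<le> e / K"
    by (simp add: algebra_simps)
  \<comment> \<open>Squaring the second gap condition bounds \<open>card S * x * e\<close> by
    \<open>s\<^sup>2 / 8100\<close>. Because \<open>e \<ge> s / 2\<close>, one factor
    \<open>s\<close> cancels and a bound on \<open>card S * x\<close> itself remains.\<close>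
  have rx: "8100 * (real (card S) * x) \<le> 2 * s"
  proof -
    have rxe: "0 \<le> real (card S) * x * e" using x0 e0 by simp
    have "90 * sqrt (real (card S) * x * e) \<le> s" using g2 by (simp add: S_def e_def)
    then have "(90 * sqrt (real (card S) * x * e))\<^sup>2 \<le> s\<^sup>2"
      using rxe by (intro power_mono) simp_all
    then have "8100 * (real (card S) * x * e) \<le> s\<^sup>2"
      using rxe by (simp add: power_mult_distrib)
    moreover have "real (card S) * x * (s / 2) \<le> real (card S) * x * e"
      using \<open>s / 2 \<le> e\<close> x0 by (intro mult_left_mono) simp_all
    ultimately have "8100 * (real (card S) * x) * s \<le> 2 * s * s"
      by (simp add: power2_eq_square algebra_simps)
    then show ?thesis using s by simp
  qed
  then have "s / 4 \<le> s / 2 - real (card S) * x" using s(1) by linarith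
  \<comment> \<open>The left side equals \<open>22 * s / 90\<close>, whereas \<open>main\<close> and
    the first gap condition bound the right side by \<open>s / 90\<close>.\<close>
  then have "s / 4 * (44 / 45) \<le> (s / 2 - real (card S) * x) * L2_set a S"
    using a_in s(1) by (intro mult_mono) linarith+
  moreover have "90 * (e / K) \<le> s" using g1 by (simp add: e_def)
  ultimately show False using main s(1) by linarith
qed

section \<open>Passage from eigenvalues to the smallest singular value\<close>

theorem theorem3p3:
  fixes A E :: "real ^ 'n ^ 'n" and u :: "'n \<Rightarrow> real ^ 'n"
    and n r :: nat and x K :: real
  assumes n: "n = CARD('n)"
    and symA: "transpose A = A" and symE: "transpose E = E"
    and pos: "singular_value A n > 0"
    and u: "orthonormal_eigenbasis A u"
    and x: "x = Max {\<bar>u i \<bullet> (E *v u j)\<bar> | i j. True}"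
    and K: "K > 0"
    and r: "r = length (filter (\<lambda>s. s \<le> singular_value A n / 2 + K * spectral_norm E)
                  (singular_values A))"
    and gap: "singular_value A n \<ge>
                90 * ln (3 + 2 * singular_value A 1 / singular_value A n) *
                max (spectral_norm E / K) (sqrt (real r * x * spectral_norm E))"
  shows "singular_value (A + E) n \<ge> singular_value A n / 2"
proof -
  obtain c where orth: "\<And>i j. u i \<bullet> u j = (if i = j then 1 else 0)"
    and eig: "\<And>i. A *v u i = c i *\<^sub>R u i"
    using u unfolding orthonormal_eigenbasis_def by metis
  have symB: "transpose (A + E) = A + E"
    using symA symE by (simp add: transpose_def vec_eq_iff)
  then obtain w where "orthonormal_eigenbasis (A + E) w"
    using symmetric_orthonormal_eigenbasis_exists by blast
  then obtain d where orthw: "\<And>i j. w i \<bullet> w j = (if i = j then 1 else 0)"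
    and eigw: "\<And>i. (A + E) *v w i = d i *\<^sub>R w i"
    unfolding orthonormal_eigenbasis_def by metis
  let ?s = "singular_value A n"
  let ?m = "max (spectral_norm E / K) (sqrt (real r * x * spectral_norm E))"
  have s_le: "?s \<le> \<bar>c i\<bar>" for i
    by (simp add: n singular_value_last[of A u c, OF symA orth eig])
  have x_le: "\<bar>u i \<bullet> (E *v u j)\<bar> \<le> x" for i j
  proof -
    \<comment> \<open>As the image of a finite type of pairs, the set is finite, so its
      \<open>Max\<close> is an upper bound.\<close>
    have "{\<bar>u i \<bullet> (E *v u j)\<bar> | i j. True} = range (\<lambda>(i, j). \<bar>u i \<bullet> (E *v u j)\<bar>)" by auto
    then have "finite {\<bar>u i \<bullet> (E *v u j)\<bar> | i j. True}" by simp
    then show ?thesis unfolding x by (intro Max_ge) auto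
  qed
  have r_card: "r = card {i. \<bar>c i\<bar> \<le> ?s / 2 + K * spectral_norm E}"
    unfolding r by (rule length_filter_singular_values[of A u c, OF symA orth eig])
  have "singular_value A 1 \<in> set (singular_values A)"
    using length_singular_values[of A u c, OF symA orth eig] by (simp add: singular_value_def)
  then have "singular_value A 1 \<ge> 0"
    using set_singular_values[of A u c, OF symA orth eig] by auto
  \<comment> \<open>Since the quotient of singular values is nonnegative,
    \<open>exp 1 \<le> 3\<close> suffices to make the logarithm at least 1.\<close>
  then have "exp 1 \<le> 3 + 2 * singular_value A 1 / ?s"
    using exp_le pos by (smt (verit) divide_nonneg_pos)
  then have "1 \<le> ln (3 + 2 * singular_value A 1 / ?s)"
    by (metis exp_gt_zero ln_exp ln_mono order_less_le_trans)
  moreover have "0 \<le> ?m"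
    using K by (simp add: le_max_iff_disj spectral_norm_def onorm_pos_le matrix_vector_mul_bounded_linear)
  ultimately have "?m \<le> ln (3 + 2 * singular_value A 1 / ?s) * ?m"
    using mult_right_mono[of 1 _ ?m] by simp
  then have m_le: "90 * ?m \<le> ?s" using gap by linarith
  have "?s / 2 \<le> \<bar>d i\<bar>" for i
  proof (rule perturbed_eigenvalue_bound[of A u c ?s E x K "w i" "d i", OF symA orth eig pos s_le x_le K])
    show "90 * (spectral_norm E / K) \<le> ?s" using m_le by linarith
    show "90 * sqrt (real (card {i. \<bar>c i\<bar> \<le> ?s / 2 + K * spectral_norm E}) * x * spectral_norm E) \<le> ?s"
      using m_le unfolding r_card by linarith
  qed (simp_all add: orthw eigw)
  then have "?s / 2 \<le> Min (range (\<lambda>i. \<bar>d i\<bar>))"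
    by (intro Min.boundedI) auto
  then show ?thesis
    by (simp add: n singular_value_last[of "A + E" w d, OF symB orthw eigw])
qed

end
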